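(* Let $a<b$ be real numbers. The quadrature rule $$ \int_a^b f(x) \, dx \approx \frac{b-a}{2} \bigl( f(b) + f(a) \bigr) - \frac{(b-a)^2}{12} \bigl( f'(b) - f'(a) \bigr) $$ is exact (i.e. equality holds) for all quadratic polynomials $f$ (real polynomials of degree at most $2$). *)

theory Defs
  imports "HOL-Analysis.Analysis" "HOL-Computational_Algebra.Polynomial"
begin

end

theory Submission
  imports Defs
begin

text \<open>
  Both sides can be evaluated in closed form from the coefficients of
  \<open>p = c\<^sub>0 + c\<^sub>1 x + c\<^sub>2 x\<^sup>2\<close>: the integral by the fundamental theorem of calculus, and
  \<open>f'(b) - f'(a) = 2 c\<^sub>2 (b - a)\<close>. The trapezoidal rule is already exact for degree one, and for
  \<open>x\<^sup>2\<close> it exceeds the integral by \<open>(b - a)\<^sup>3 / 6\<close>, which is exactly what the derivative term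
  removes.
\<close>

lemma poly_degree_le_2_expand:
  fixes p :: "'a::zero poly"
  assumes "degree p \<le> 2"
  shows "p = [:coeff p 0, coeff p 1, coeff p 2:]"
  using assms
  by (intro poly_eqI) (auto simp: coeff_pCons numeral_2_eq_2 coeff_eq_0 split: nat.split)

theorem mainTheorem8:
  fixes a b :: real and p :: "real poly"
  assumes "a < b" and "degree p \<le> 2"
  shows "integral {a..b} (poly p) =
           (b - a) / 2 * (poly p b + poly p a)
           - (b - a)\<^sup>2 / 12 * (deriv (poly p) b - deriv (poly p) a)"
proof -
  obtain c0 c1 c2 where p: "p = [:c0, c1, c2:]"
    using poly_degree_le_2_expand[OF assms(2)] by blast
  define P where "P = [:0, c0, c1 / 2, c2 / 3:]"
  have "pderiv P = p"
    by (simp add: P_def p pderiv_pCons)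
  hence "(poly P has_vector_derivative poly p x) (at x within {a..b})" for x
    using poly_DERIV[of P x]
    by (auto simp: has_real_derivative_iff_has_vector_derivative
             intro: has_vector_derivative_at_within)
  hence "(poly p has_integral (poly P b - poly P a)) {a..b}"
    using assms(1) by (intro fundamental_theorem_of_calculus) auto
  hence integral: "integral {a..b} (poly p) = poly P b - poly P a"
    by (rule integral_unique)
  have deriv: "deriv (poly p) x = c1 + 2 * c2 * x" for x
    by (subst DERIV_imp_deriv[OF poly_DERIV]) (simp add: p pderiv_pCons algebra_simps)
  show ?thesis
    unfolding integral deriv
    by (simp add: P_def p field_simps power2_eq_square)
qed

end
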